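(* There is a constant $C>0$ such that for every integer $n\ge2$ there exists an online randomized $\beta$-approximate embedding of the class of loop-free binary matroids with at most $n$ elements into the free matroid $\mathbf{Fr}_n$, with $\beta\le C\,n/\log n$.
   Context: A matroid is loop-free if every singleton is independent. A matroid is binary if it admits a rank-preserving map (morphism) into $\mathbb{F}_2^d$ (vectors with linear independence) for some $d$. $\mathbf{Fr}_n$ is the free matroid on $[n]$: every subset is independent, $\mathrm{rank}(S)=|S|$. An ordering of $\mathbf{M}$ with $|\mathbf{M}|=m$ is a bijection $\pi:[m]\to\mathbf{M}$; for $m'<m$ the prefix-restriction $(\mathbf{M}',\pi')$ is the restriction of $\mathbf{M}$ to $\pi([m'])$ with $\pi'=\pi|_{[m']}$. An online randomized $\beta$-approximate embedding of a class $\mathcal{C}$ into a matroid $\mathbf{BigM}$ is a family of maps $f_{\mathbf{M},\pi,r}:\mathbf{M}\to\mathbf{BigM}$ for $\mathbf{M}\in\mathcal{C}$, orderings $\pi$, and $r$ drawn from a random variable $R$, such that (i) for each fixed $\mathbf{M},\pi$: $\mathrm{rank}_{\mathbf{BigM}}(f_{\mathbf{M},\pi,r}(S))\le\mathrm{rank}_{\mathbf{M}}(S)$ almost surely and $\mathbb{E}_r[\mathrm{rank}_{\mathbf{BigM}}(f_{\mathbf{M},\pi,r}(S))]\ge\frac1\beta\mathrm{rank}_{\mathbf{M}}(S)$ for all $S\subseteq\mathbf{M}$; (ii) for each $r$ and every prefix-restriction $(\mathbf{M}',\pi')$ of $(\mathbf{M},\pi)$, $f_{\mathbf{M}',\pi',r}$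 is the restriction of $f_{\mathbf{M},\pi,r}$ to $\mathbf{M}'$. *)

theory Defs
  imports "HOL-Probability.Probability" "HOL-Library.Z2" "HOL-Library.Function_Algebras"
begin

section \<open>Finite matroids\<close>

record 'a pre_matroid =
  ground :: "'a set"
  indeps :: "'a set set"

definition matroid :: "'a pre_matroid \<Rightarrow> bool" where
  "matroid M \<longleftrightarrow>
     finite (ground M) \<and> indeps M \<subseteq> Pow (ground M) \<and> {} \<in> indeps M \<and>
     (\<forall>I\<in>indeps M. \<forall>J\<subseteq>I. J \<in> indeps M) \<and>
     (\<forall>I\<in>indeps M. \<forall>J\<in>indeps M. card I < card J \<longrightarrow> (\<exists>x\<in>J - I. insert x I \<in> indeps M))"

definition rank :: "'a pre_matroid \<Rightarrow> 'a set \<Rightarrow> nat" where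
  "rank M S = Max (card ` {I \<in> indeps M. I \<subseteq> S})"

definition restriction :: "'a pre_matroid \<Rightarrow> 'a set \<Rightarrow> 'a pre_matroid" where
  "restriction M X = \<lparr>ground = X, indeps = {I \<in> indeps M. I \<subseteq> X}\<rparr>"

definition loop_free :: "'a pre_matroid \<Rightarrow> bool" where
  "loop_free M \<longleftrightarrow> (\<forall>x\<in>ground M. {x} \<in> indeps M)"

definition rank_preserving :: "'a pre_matroid \<Rightarrow> 'b pre_matroid \<Rightarrow> ('a \<Rightarrow> 'b) \<Rightarrow> bool" where
  "rank_preserving M N \<phi> \<longleftrightarrow>
     \<phi> \<in> ground M \<rightarrow> ground N \<and> (\<forall>S\<subseteq>ground M. rank N (\<phi> ` S) = rank M S)"

definition free_matroid :: "nat \<Rightarrow> nat pre_matroid" where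
  "free_matroid n = \<lparr>ground = {1..n}, indeps = Pow {1..n}\<rparr>"

lemma matroid_free_matroid: "matroid (free_matroid n)"
proof -
  have "\<exists>x\<in>J - I. insert x I \<subseteq> {1..n}"
    if "I \<subseteq> {1..n}" "J \<subseteq> {1..n}" "card I < card J" for I J :: "nat set"
  proof -
    have "\<not> J \<subseteq> I"
      using that card_mono[of I J] finite_subset[of I "{1..n}"] by auto
    then show ?thesis using that by blast
  qed
  then show ?thesis
    unfolding matroid_def free_matroid_def by auto
qed

lemma rank_free_matroid:
  assumes "S \<subseteq> {1..n}" shows "rank (free_matroid n) S = card S"
proof -
  have fin: "finite S" using assms finite_subset by blast
  then have "finite {I \<in> Pow {1..n}. I \<subseteq> S}" by (auto intro: rev_finite_subset[of "Pow S"])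
  moreover have "S \<in> {I \<in> Pow {1..n}. I \<subseteq> S}" using assms by auto
  ultimately show ?thesis
    using fin unfolding rank_def free_matroid_def
    by (auto intro!: Max_eqI card_mono)
qed

section \<open>Binary matroids\<close>

text \<open>
  The space of sequences over the two-element field \<^typ>\<open>bit\<close>; the space of dimension
  \<open>d\<close> is the subspace of sequences vanishing from index \<open>d\<close> on, so that \<open>d\<close> can be
  quantified over.
\<close>

definition scale_F2 :: "bit \<Rightarrow> (nat \<Rightarrow> bit) \<Rightarrow> nat \<Rightarrow> bit" where
  "scale_F2 c v = (\<lambda>i. c * v i)"

interpretation F2: vector_space scale_F2
  by unfold_locales (auto simp: scale_F2_def fun_eq_iff algebra_simps)

definition F2_space :: "nat \<Rightarrow> (nat \<Rightarrow> bit) set" where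
  "F2_space d = {v. \<forall>i\<ge>d. v i = 0}"

definition F2_matroid :: "nat \<Rightarrow> (nat \<Rightarrow> bit) pre_matroid" where
  "F2_matroid d = \<lparr>ground = F2_space d, indeps = {B. B \<subseteq> F2_space d \<and> F2.independent B}\<rparr>"

lemma finite_F2_space: "finite (F2_space d)"
proof -
  have "F2_space d \<subseteq> (\<lambda>A i. if i \<in> A then 1 else 0) ` Pow {..<d}"
  proof
    fix v assume "v \<in> F2_space d"
    then have "v = (\<lambda>i. if i \<in> {i. v i = 1} then 1 else 0)" "{i. v i = 1} \<subseteq> {..<d}"
      by (auto simp: F2_space_def fun_eq_iff not_le[symmetric])
    then show "v \<in> (\<lambda>A i. if i \<in> A then 1 else 0) ` Pow {..<d}" by blast
  qed
  then show ?thesis by (rule finite_subset) simp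
qed

lemma matroid_F2_matroid: "matroid (F2_matroid d)"
proof -
  have "\<exists>x\<in>J - I. insert x I \<subseteq> F2_space d \<and> F2.independent (insert x I)"
    if I: "I \<subseteq> F2_space d" "F2.independent I" and J: "J \<subseteq> F2_space d" "F2.independent J"
      and less: "card I < card J" for I J
  proof -
    have fin: "finite I" using I finite_F2_space finite_subset by blast
    have "\<not> J \<subseteq> F2.span I"
      using F2.independent_span_bound[OF fin J(2)] less by auto
    then obtain x where "x \<in> J" "x \<notin> F2.span I" by blast
    then show ?thesis
      using I J F2.span_base[of x I] by (auto simp: F2.independent_insert)
  qed
  then show ?thesis
    unfolding matroid_def F2_matroid_def
    by (auto simp: finite_F2_space dest: F2.independent_mono simp: F2.independent_empty)
qed

definition binary :: "'a pre_matroid \<Rightarrow> bool" where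
  "binary M \<longleftrightarrow> (\<exists>d \<phi>. rank_preserving M (F2_matroid d) \<phi>)"

definition loop_free_binary_matroids :: "nat \<Rightarrow> 'a pre_matroid set" where
  "loop_free_binary_matroids n =
     {M. matroid M \<and> loop_free M \<and> binary M \<and> card (ground M) \<le> n}"

section \<open>Online randomized embeddings\<close>

text \<open>
  Orderings are extensional, so that they carry no information outside their domain.
\<close>

definition ordering :: "'a pre_matroid \<Rightarrow> (nat \<Rightarrow> 'a) \<Rightarrow> bool" where
  "ordering M \<pi> \<longleftrightarrow>
     \<pi> \<in> extensional {1..card (ground M)} \<and> bij_betw \<pi> {1..card (ground M)} (ground M)"

text \<open>
  The probability measure \<open>R\<close> is the law of the random seed \<open>r\<close>. The integrability clause
  says that the expectation exists (a Bochner integral is \<open>0\<close> otherwise), and \<open>\<beta> > 0\<close> keeps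
  \<open>1 / \<beta>\<close> meaningful.
\<close>

definition online_randomized_embedding ::
  "'a pre_matroid set \<Rightarrow> 'b pre_matroid \<Rightarrow> real \<Rightarrow> 'r measure \<Rightarrow>
   ('a pre_matroid \<Rightarrow> (nat \<Rightarrow> 'a) \<Rightarrow> 'r \<Rightarrow> 'a \<Rightarrow> 'b) \<Rightarrow> bool" where
  "online_randomized_embedding \<C> N \<beta> R f \<longleftrightarrow>
     \<beta> > 0 \<and> prob_space R \<and>
     (\<forall>M\<in>\<C>. \<forall>\<pi>. ordering M \<pi> \<longrightarrow>
        (\<forall>r\<in>space R. f M \<pi> r \<in> ground M \<rightarrow> ground N) \<and>
        (\<forall>S\<subseteq>ground M.
           (AE r in R. rank N (f M \<pi> r ` S) \<le> rank M S) \<and>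
           integrable R (\<lambda>r. real (rank N (f M \<pi> r ` S))) \<and>
           (\<integral>r. real (rank N (f M \<pi> r ` S)) \<partial>R) \<ge> 1 / \<beta> * real (rank M S)) \<and>
        (\<forall>r\<in>space R. \<forall>m'<card (ground M). \<forall>x\<in>\<pi> ` {1..m'}.
           f (restriction M (\<pi> ` {1..m'})) (restrict \<pi> {1..m'}) r x = f M \<pi> r x))"

text \<open>
  Every finite matroid over \<^typ>\<open>'a\<close> can be relabelled over \<^typ>\<open>nat\<close> along an ordering, so an
  embedding of the natural-number instance of the class yields one for any type of elements,
  with the same \<open>\<beta>\<close> and the same seed. Constants obtained for \<^typ>\<open>nat\<close> are thus valid for all types.
\<close>

definition relabel :: "'a pre_matroid \<Rightarrow> (nat \<Rightarrow> 'a) \<Rightarrow> nat pre_matroid" where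
  "relabel M \<pi> = \<lparr>ground = {1..card (ground M)},
     indeps = {A. A \<subseteq> {1..card (ground M)} \<and> \<pi> ` A \<in> indeps M}\<rparr>"

lemma rank_relabel:
  assumes "ordering M \<pi>" "A \<subseteq> {1..card (ground M)}"
  shows "rank (relabel M \<pi>) A = rank M (\<pi> ` A)"
proof -
  have inj: "inj_on \<pi> A"
    using assms unfolding ordering_def bij_betw_def by (blast intro: inj_on_subset)
  have "{J \<in> indeps M. J \<subseteq> \<pi> ` A} = image \<pi> ` {I \<in> indeps (relabel M \<pi>). I \<subseteq> A}"
    using assms(2) unfolding relabel_def by (auto simp: subset_image_iff)
  then have "card ` {J \<in> indeps M. J \<subseteq> \<pi> ` A} =
      (\<lambda>I. card (\<pi> ` I)) ` {I \<in> indeps (relabel M \<pi>). I \<subseteq> A}"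
    by (simp add: image_image)
  also have "\<dots> = card ` {I \<in> indeps (relabel M \<pi>). I \<subseteq> A}"
    by (intro image_cong refl card_image) (use inj in \<open>blast intro: inj_on_subset\<close>)
  finally show ?thesis by (simp add: rank_def)
qed

lemma matroid_relabel:
  assumes "ordering M \<pi>" "matroid M"
  shows "matroid (relabel M \<pi>)"
proof -
  let ?m = "card (ground M)"
  have inj: "inj_on \<pi> {1..?m}" using assms(1) by (auto simp: ordering_def bij_betw_def)
  have empty: "{} \<in> indeps M"
    and down: "\<And>I J. I \<in> indeps M \<Longrightarrow> J \<subseteq> I \<Longrightarrow> J \<in> indeps M"
    and exch: "\<And>I J. I \<in> indeps M \<Longrightarrow> J \<in> indeps M \<Longrightarrow> card I < card J \<Longrightarrow>
      \<exists>x\<in>J - I. insert x I \<in> indeps M"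
    using assms(2) unfolding matroid_def by simp_all
  have "\<exists>x\<in>J - I. insert x I \<subseteq> {1..?m} \<and> \<pi> ` insert x I \<in> indeps M"
    if I: "I \<subseteq> {1..?m}" "\<pi> ` I \<in> indeps M" and J: "J \<subseteq> {1..?m}" "\<pi> ` J \<in> indeps M"
      and less: "card I < card J" for I J
  proof -
    have "card (\<pi> ` I) = card I" "card (\<pi> ` J) = card J"
      by (rule card_image[OF inj_on_subset[OF inj I(1)]], rule card_image[OF inj_on_subset[OF inj J(1)]])
    then obtain y where y: "y \<in> \<pi> ` J - \<pi> ` I" "insert y (\<pi> ` I) \<in> indeps M"
      using exch[OF I(2) J(2)] less by auto
    then obtain x where x: "x \<in> J" "y = \<pi> x" by blast
    then have "x \<notin> I" using y(1) by blast
    moreover have "insert x I \<subseteq> {1..?m}" using x(1) I(1) J(1) by blast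
    moreover have "\<pi> ` insert x I \<in> indeps M" using y(2) x(2) by simp
    ultimately show ?thesis using x(1) by blast
  qed
  moreover have "J \<subseteq> {1..?m} \<and> \<pi> ` J \<in> indeps M"
    if "I \<subseteq> {1..?m} \<and> \<pi> ` I \<in> indeps M" "J \<subseteq> I" for I J
    using that down[of "\<pi> ` I" "\<pi> ` J"] by (simp add: image_mono order_trans[of J I])
  ultimately show ?thesis
    using empty unfolding matroid_def relabel_def pre_matroid.simps mem_Collect_eq
    by (intro conjI ballI allI impI) (simp_all add: subset_iff Pow_def)
qed

lemma relabel_loop_free_binary:
  assumes "ordering M \<pi>" "M \<in> loop_free_binary_matroids n"
  shows "relabel M \<pi> \<in> loop_free_binary_matroids n"
proof -
  let ?m = "card (ground M)"
  have im: "\<pi> ` {1..?m} = ground M" using assms(1) by (auto simp: ordering_def bij_betw_def)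
  have "loop_free (relabel M \<pi>)"
    using assms(2) im unfolding loop_free_binary_matroids_def loop_free_def relabel_def by auto
  moreover obtain d \<phi> where \<phi>: "rank_preserving M (F2_matroid d) \<phi>"
    using assms(2) unfolding loop_free_binary_matroids_def binary_def by blast
  have "rank_preserving (relabel M \<pi>) (F2_matroid d) (\<phi> \<circ> \<pi>)"
    unfolding rank_preserving_def
  proof (intro conjI allI impI)
    show "\<phi> \<circ> \<pi> \<in> ground (relabel M \<pi>) \<rightarrow> ground (F2_matroid d)"
      using \<phi> im unfolding rank_preserving_def relabel_def by fastforce
    fix S assume "S \<subseteq> ground (relabel M \<pi>)"
    then have S: "S \<subseteq> {1..?m}" by (simp add: relabel_def)
    then have "\<pi> ` S \<subseteq> ground M" using im by blast
    then have "rank (F2_matroid d) (\<phi> ` \<pi> ` S) = rank M (\<pi> ` S)"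
      using \<phi> unfolding rank_preserving_def by blast
    then show "rank (F2_matroid d) ((\<phi> \<circ> \<pi>) ` S) = rank (relabel M \<pi>) S"
      by (simp only: image_comp rank_relabel[OF assms(1) S])
  qed
  ultimately show ?thesis
    using assms matroid_relabel[OF assms(1)]
    by (auto simp: loop_free_binary_matroids_def binary_def relabel_def)
qed

lemma online_randomized_embedding_relabel:
  assumes "online_randomized_embedding (loop_free_binary_matroids n :: nat pre_matroid set) N \<beta> R f"
  shows "\<exists>g. online_randomized_embedding (loop_free_binary_matroids n :: 'a pre_matroid set) N \<beta> R g"
proof -
  define idx where "idx M \<pi> = inv_into {1..card (ground M)} \<pi>"
    for M :: "'a pre_matroid" and \<pi> :: "nat \<Rightarrow> 'a"
  define g where "g M \<pi> r x =
      f (relabel M \<pi>) (restrict id {1..card (ground M)}) r (idx M \<pi> x)"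
    for M :: "'a pre_matroid" and \<pi> r x
  have "(\<forall>r\<in>space R. g M \<pi> r \<in> ground M \<rightarrow> ground N) \<and>
        (\<forall>S\<subseteq>ground M.
           (AE r in R. rank N (g M \<pi> r ` S) \<le> rank M S) \<and>
           integrable R (\<lambda>r. real (rank N (g M \<pi> r ` S))) \<and>
           (\<integral>r. real (rank N (g M \<pi> r ` S)) \<partial>R) \<ge> 1 / \<beta> * real (rank M S)) \<and>
        (\<forall>r\<in>space R. \<forall>m'<card (ground M). \<forall>x\<in>\<pi> ` {1..m'}.
           g (restriction M (\<pi> ` {1..m'})) (restrict \<pi> {1..m'}) r x = g M \<pi> r x)"
    if M: "M \<in> loop_free_binary_matroids n" and \<pi>: "ordering M \<pi>" for M :: "'a pre_matroid" and \<pi>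
  proof -
    let ?m = "card (ground M)"
    let ?M = "relabel M \<pi>" and ?\<iota> = "restrict id {1..?m} :: nat \<Rightarrow> nat"
    have inj: "inj_on \<pi> {1..?m}" and im: "\<pi> ` {1..?m} = ground M"
      using \<pi> by (auto simp: ordering_def bij_betw_def)
    have gr: "ground ?M = {1..?m}" by (simp add: relabel_def)
    have ord: "ordering ?M ?\<iota>" by (auto simp: ordering_def gr bij_betw_def inj_on_def)
    have mem: "?M \<in> loop_free_binary_matroids n" by (rule relabel_loop_free_binary[OF \<pi> M])
    have F: "(\<forall>r\<in>space R. f ?M ?\<iota> r \<in> {1..?m} \<rightarrow> ground N) \<and>
        (\<forall>S\<subseteq>{1..?m}.
           (AE r in R. rank N (f ?M ?\<iota> r ` S) \<le> rank ?M S) \<and>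
           integrable R (\<lambda>r. real (rank N (f ?M ?\<iota> r ` S))) \<and>
           (\<integral>r. real (rank N (f ?M ?\<iota> r ` S)) \<partial>R) \<ge> 1 / \<beta> * real (rank ?M S)) \<and>
        (\<forall>r\<in>space R. \<forall>m'<?m. \<forall>x\<in>?\<iota> ` {1..m'}.
           f (restriction ?M (?\<iota> ` {1..m'})) (restrict ?\<iota> {1..m'}) r x = f ?M ?\<iota> r x)"
      using assms[unfolded online_randomized_embedding_def, THEN conjunct2, THEN conjunct2,
          THEN bspec, OF mem, THEN spec, THEN mp, OF ord]
      unfolding gr card_atLeastAtMost by simp
    note F1 = F[THEN conjunct1, rule_format]
    note F2 = F[THEN conjunct2, THEN conjunct1, rule_format]
    note F3 = F[THEN conjunct2, THEN conjunct2, rule_format]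
    have idx_im: "idx M \<pi> x \<in> {1..?m}" if "x \<in> ground M" for x
      using that inv_into_into[of x \<pi> "{1..?m}"] unfolding idx_def im by blast
    have idx: "idx M \<pi> (\<pi> j) = j" if "j \<in> {1..?m}" for j
      using that inj by (simp add: idx_def)
    have 1: "g M \<pi> r \<in> ground M \<rightarrow> ground N" if "r \<in> space R" for r
      using F1[OF that] idx_im by (simp add: g_def Pi_iff)
    have 2: "(AE r in R. rank N (g M \<pi> r ` S) \<le> rank M S) \<and>
           integrable R (\<lambda>r. real (rank N (g M \<pi> r ` S))) \<and>
           (\<integral>r. real (rank N (g M \<pi> r ` S)) \<partial>R) \<ge> 1 / \<beta> * real (rank M S)"
      if S: "S \<subseteq> ground M" for S
    proof -
      let ?A = "idx M \<pi> ` S"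
      have A: "?A \<subseteq> {1..?m}" using S idx_im by blast
      have "\<pi> (idx M \<pi> x) = x" if "x \<in> S" for x
        using that S im by (auto simp: idx_def f_inv_into_f)
      then have "\<pi> ` ?A = S" by (auto simp: image_image)
      then have "rank ?M ?A = rank M S" using rank_relabel[OF \<pi> A] by simp
      moreover have "g M \<pi> r ` S = f ?M ?\<iota> r ` ?A" for r
        by (simp add: g_def image_image)
      ultimately show ?thesis using F2[OF A] by simp
    qed
    have 3: "g (restriction M (\<pi> ` {1..m'})) (restrict \<pi> {1..m'}) r x = g M \<pi> r x"
      if r: "r \<in> space R" and m': "m' < ?m" and x: "x \<in> \<pi> ` {1..m'}" for r m' x
    proof -
      let ?M' = "restriction M (\<pi> ` {1..m'})" and ?\<pi>' = "restrict \<pi> {1..m'}"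
      have sub: "{1..m'} \<subseteq> {1..?m}" using m' by auto
      have inj': "inj_on \<pi> {1..m'}" using inj sub by (rule inj_on_subset)
      have card: "card (ground ?M') = m'" using inj' by (simp add: restriction_def card_image)
      have img: "?\<pi>' ` A = \<pi> ` A" if "A \<subseteq> {1..m'}" for A
        using that by (intro image_cong) auto
      have im\<iota>: "?\<iota> ` {1..m'} = {1..m'}" using sub by force
      have "A \<subseteq> {1..m'} \<and> ?\<pi>' ` A \<in> indeps M \<and> ?\<pi>' ` A \<subseteq> \<pi> ` {1..m'} \<longleftrightarrow>
          (A \<subseteq> {1..?m} \<and> \<pi> ` A \<in> indeps M) \<and> A \<subseteq> {1..m'}" for A
      proof (cases "A \<subseteq> {1..m'}")
        case True
        then show ?thesis
          using order_trans[OF True sub] image_mono[OF True, of \<pi>] by (simp only: img simp_thms)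
      qed simp
      then have M': "relabel ?M' ?\<pi>' = restriction ?M (?\<iota> ` {1..m'})"
        unfolding relabel_def card im\<iota> by (simp only: restriction_def pre_matroid.simps mem_Collect_eq)
      have \<iota>': "restrict id {1..m'} = restrict ?\<iota> {1..m'}" using m' by (auto simp: fun_eq_iff)
      obtain j where j: "j \<in> {1..m'}" "x = \<pi> j" using x by blast
      have jm: "j \<in> {1..?m}" using j(1) sub by (rule subsetD[rotated])
      have "inj_on ?\<pi>' {1..m'}" using inj' unfolding inj_on_restrict_eq .
      from inv_into_f_f[OF this j(1)] have i1: "idx ?M' ?\<pi>' x = j"
        unfolding idx_def card restrict_apply'[OF j(1)] j(2) .
      have i2: "idx M \<pi> x = j" using idx[OF jm] unfolding j(2) .
      have "j \<in> ?\<iota> ` {1..m'}" using j(1) unfolding im\<iota> .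
      from F3[OF r m' this] show ?thesis unfolding g_def i1 i2 card M' \<iota>' .
    qed
    show ?thesis by (intro conjI ballI allI impI 1 2 3)
  qed
  note key = this
  have "\<beta> > 0" "prob_space R"
    using assms unfolding online_randomized_embedding_def by simp_all
  then have "online_randomized_embedding (loop_free_binary_matroids n) N \<beta> R g"
    unfolding online_randomized_embedding_def
    by (intro conjI[OF _ conjI] ballI[of "loop_free_binary_matroids n"] allI impI key)
  then show ?thesis by (rule exI[where x = g])
qed

end

theory Submission imports Defs begin

text \<open>
  Represent the matroid by vectors over the two-element field and draw random linear functionals
  \<open>l\<^sub>1, \<dots>, l\<^sub>n\<^sub>-\<^sub>1\<close>, where each element not spanned by its predecessors receives fresh random
  values and the values of every other element are forced by its fundamental circuit; this can be
  done online, from the matroid alone. Map a vector \<open>v\<close> to the least \<open>t\<close> with \<open>l\<^sub>t v = 1\<close>, and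
  to \<open>n\<close> if there is none. Nonzero vectors with distinct images are triangular with respect to the
  functionals, hence independent, so images have cardinality at most the rank. Among \<open>k\<close>
  independent vectors each value \<open>t \<le> log\<^sub>2 k\<close> is attained with probability at least \<open>1/2\<close>, so the
  expected cardinality of the image of a set of rank \<open>k\<close> is of order \<open>log k\<close>, which is at least of
  order \<open>k log n / n\<close>.
\<close>

section \<open>Parities of random subsets\<close>

text \<open>Toggling the membership of \<open>i\<close> is an involution that flips the parity of
  \<open>D \<inter> W\<close> and preserves \<open>P\<close>, so it pairs off the two parity
  classes. Keeping \<open>P\<close> general allows another parity to be fixed beforehand.\<close>

lemma card_parity_halves:
  assumes "finite V" "i \<in> V" "i \<in> D" "finite D"
    and inv: "\<And>W. i \<notin> W \<Longrightarrow> P (insert i W) \<longleftrightarrow> P W"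
  shows "2 * card {W \<in> Pow V. P W \<and> (odd (card (D \<inter> W)) \<longleftrightarrow> a)} = card {W \<in> Pow V. P W}"
proof -
  define A where "A b = {W \<in> Pow V. P W \<and> (odd (card (D \<inter> W)) \<longleftrightarrow> b)}" for b
  define T where "T W = (if i \<in> W then W - {i} else insert i W)" for W
  have TT: "T (T W) = W" for W by (auto simp: T_def)
  have PT: "P (T W) = P W" for W
    using inv[of W] inv[of "W - {i}"] by (auto simp: T_def insert_absorb)
  have par: "odd (card (D \<inter> T W)) \<longleftrightarrow> even (card (D \<inter> W))" for W
  proof (cases "i \<in> W")
    case True
    then have "D \<inter> W = insert i (D \<inter> T W)" "i \<notin> D \<inter> T W" using assms by (auto simp: T_def)
    then show ?thesis using assms(4) by simp
  next
    case False
    then have "D \<inter> T W = insert i (D \<inter> W)" "i \<notin> D \<inter> W" using assms by (auto simp: T_def)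
    then show ?thesis using assms(4) by simp
  qed
  have TV: "T W \<subseteq> V" if "W \<subseteq> V" for W using that assms(2) by (auto simp: T_def)
  have TA: "T W \<in> A (\<not> b)" if "W \<in> A b" for W b
    using that TV PT par by (auto simp: A_def)
  have "bij_betw T (A a) (A (\<not> a))"
    by (rule bij_betw_byWitness[where f' = T]) (use TA[of _ a] TA[of _ "\<not> a"] TT in auto)
  then have "card (A a) = card (A (\<not> a))" by (rule bij_betw_same_card)
  moreover have "{W \<in> Pow V. P W} = A a \<union> A (\<not> a)" "A a \<inter> A (\<not> a) = {}"
    by (auto simp: A_def)
  moreover have "finite (A b)" for b using assms(1) by (simp add: A_def)
  ultimately have "2 * card (A a) = card {W \<in> Pow V. P W}" by (simp only: card_Un_disjoint)
  then show ?thesis by (simp only: A_def)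
qed

lemma card_parity:
  assumes "finite V" "D \<subseteq> V" "D \<noteq> {}"
  shows "2 * card {W \<in> Pow V. odd (card (D \<inter> W)) \<longleftrightarrow> a} = card (Pow V)"
proof -
  obtain i where "i \<in> D" using assms(3) by blast
  then show ?thesis
    using card_parity_halves[of V i D "\<lambda>_. True" a] assms finite_subset[OF assms(2,1)]
    by (auto simp: Pow_def)
qed

text \<open>Pairwise independence: of two distinct sets, one has an element \<open>i\<close> outside
  the other. Toggling \<open>i\<close> leaves the other parity alone, so the two conditions halve
  the count one after the other.\<close>

lemma card_parity_pair:
  assumes V: "finite V" and D: "D \<subseteq> V" "D \<noteq> {}" and E: "E \<subseteq> V" "E \<noteq> {}" and "D \<noteq> E"
  shows "4 * card {W \<in> Pow V. (odd (card (D \<inter> W)) \<longleftrightarrow> a) \<and> (odd (card (E \<inter> W)) \<longleftrightarrow> a)} = card (Pow V)"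
proof -
  have *: "4 * card {W \<in> Pow V. (odd (card (E \<inter> W)) \<longleftrightarrow> a) \<and> (odd (card (D \<inter> W)) \<longleftrightarrow> a)} = card (Pow V)"
    if "D \<subseteq> V" "E \<subseteq> V" "E \<noteq> {}" "i \<in> D" "i \<notin> E" for D E :: "'a set" and i
  proof -
    have "2 * card {W \<in> Pow V. (odd (card (E \<inter> W)) \<longleftrightarrow> a) \<and> (odd (card (D \<inter> W)) \<longleftrightarrow> a)}
        = card {W \<in> Pow V. odd (card (E \<inter> W)) \<longleftrightarrow> a}"
      using that by (intro card_parity_halves[of V i D]) (auto simp: V intro: finite_subset[OF _ V])
    then show ?thesis using card_parity[OF V that(2,3), of a] by simp
  qed
  consider i where "i \<in> D" "i \<notin> E" | i where "i \<in> E" "i \<notin> D" using \<open>D \<noteq> E\<close> by blast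
  then show ?thesis
  proof cases
    case 1
    then show ?thesis using *[of D E i] D E by (simp add: conj_commute)
  next
    case 2
    then show ?thesis using *[of E D i] D E by simp
  qed
qed

section \<open>Colours\<close>

text \<open>
  A seed consists of random sets \<open>\<omega> 1, \<dots>, \<omega> (n - 1)\<close>, encoding random linear functionals on the
  space spanned by the greedy basis; a vector is represented by the set \<open>D\<close> of basis elements
  whose sum it is, and \<open>\<omega> t\<close> evaluates to the parity of \<open>D \<inter> \<omega> t\<close>.
\<close>

definition seeds :: "nat \<Rightarrow> (nat \<Rightarrow> nat set) set" where
  "seeds n = (\<Pi>\<^sub>E t\<in>{1..<n}. Pow {1..n})"

definition colour :: "nat \<Rightarrow> (nat \<Rightarrow> nat set) \<Rightarrow> nat set \<Rightarrow> nat" where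
  "colour n \<omega> D = Min (insert n {t \<in> {1..<n}. odd (card (D \<inter> \<omega> t))})"

lemma finite_seeds: "finite (seeds n)" and seeds_nonempty: "seeds n \<noteq> {}"
  by (auto simp: seeds_def PiE_eq_empty_iff intro!: finite_PiE)

lemma colour_range: "1 \<le> n \<Longrightarrow> colour n \<omega> D \<in> {1..n}"
  using Min_in[of "insert n {t \<in> {1..<n}. odd (card (D \<inter> \<omega> t))}"] by (auto simp: colour_def)

text \<open>Each of the first \<open>t\<close> coordinates of the seed gets one prescribed parity,
  so the event is a product of independent conditions. The default colour \<open>n\<close> has no
  functional and is excluded.\<close>

lemma colour_eq_iff:
  assumes "t \<in> {1..<n}"
  shows "colour n \<omega> D = t \<longleftrightarrow> (\<forall>s\<in>{1..t}. odd (card (D \<inter> \<omega> s)) \<longleftrightarrow> s = t)"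
  using assms unfolding colour_def
  by (subst Min_eq_iff) (force simp: not_less[symmetric])+

lemma odd_if_colour_lt:
  assumes "1 \<le> n" "colour n \<omega> D < n"
  shows "odd (card (D \<inter> \<omega> (colour n \<omega> D)))"
  using assms colour_eq_iff[of "colour n \<omega> D" n \<omega> D] colour_range[of n \<omega> D] by auto

lemma even_if_lt_colour:
  assumes "1 \<le> t" "t < n" "t < colour n \<omega> D"
  shows "even (card (D \<inter> \<omega> t))"
proof (rule ccontr)
  assume "\<not> ?thesis"
  then have "colour n \<omega> D \<le> t" using assms unfolding colour_def by (intro Min_le) auto
  then show False using assms by simp
qed

section \<open>Probabilities of single colours and the expected number of colours\<close>

lemma card_seeds_constrained:
  assumes t: "t < n" and q: "\<And>s. s \<in> {1..t} \<Longrightarrow> q * card {W \<in> Pow {1..n}. P s W} = card (Pow {1..n})"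
  shows "q ^ t * card {\<omega> \<in> seeds n. \<forall>s\<in>{1..t}. P s (\<omega> s)} = card (seeds n)"
proof -
  \<comment> \<open>The implication leaves coordinates beyond \<open>t\<close> unrestricted, so the
    constrained seeds form a single product set in which each of the first \<open>t\<close> factors
    is cut down to a fraction \<open>1 / q\<close>.\<close>
  let ?A = "\<lambda>s. {W \<in> Pow {1..n}. s \<le> t \<longrightarrow> P s W}"
  have split: "{1..<n} = {1..t} \<union> {t<..<n}" using t by auto
  have eq: "{\<omega> \<in> seeds n. \<forall>s\<in>{1..t}. P s (\<omega> s)} = Pi\<^sub>E {1..<n} ?A"
    using t by (auto simp: seeds_def PiE_def Pi_def)
  have "q ^ t * card {\<omega> \<in> seeds n. \<forall>s\<in>{1..t}. P s (\<omega> s)}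
      = (\<Prod>s\<in>{1..t}. q * card (?A s)) * (\<Prod>s\<in>{t<..<n}. card (?A s))"
    unfolding eq card_PiE[OF finite_atLeastLessThan] unfolding split
    by (subst prod.union_disjoint) (auto simp: prod.distrib)
  also have "\<dots> = (\<Prod>s\<in>{1..t}. card (Pow {1..n})) * (\<Prod>s\<in>{t<..<n}. card (Pow {1..n}))"
    by (intro arg_cong2[where f = "(*)"] prod.cong refl) (use q in \<open>auto simp: Pow_def\<close>)
  also have "\<dots> = card (seeds n)"
    unfolding seeds_def card_PiE[OF finite_atLeastLessThan] unfolding split
    by (subst prod.union_disjoint) auto
  finally show ?thesis .
qed

lemma card_colour_eq:
  assumes t: "t \<in> {1..<n}" and D: "D \<subseteq> {1..n}" "D \<noteq> {}"
  shows "2 ^ t * card {\<omega> \<in> seeds n. colour n \<omega> D = t} = card (seeds n)"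
  unfolding colour_eq_iff[OF t] using t card_parity[OF _ D]
  by (intro card_seeds_constrained) auto

lemma card_colour_pair_eq:
  assumes t: "t \<in> {1..<n}" and D: "D \<subseteq> {1..n}" "D \<noteq> {}" and E: "E \<subseteq> {1..n}" "E \<noteq> {}" and "D \<noteq> E"
  shows "4 ^ t * card {\<omega> \<in> seeds n. colour n \<omega> D = t \<and> colour n \<omega> E = t} = card (seeds n)"
  unfolding colour_eq_iff[OF t] ball_conj_distrib[symmetric]
  using t card_parity_pair[OF _ D E \<open>D \<noteq> E\<close>] by (intro card_seeds_constrained) auto

text \<open>
  Second moment method: the number \<open>X\<close> of hits satisfies \<open>E X = 1\<close>, and \<open>E X\<^sup>2 \<le> 2\<close> by pairwise
  independence, whereas \<open>3 X - X\<^sup>2 \<le> 2\<close> always and \<open>3 X - X\<^sup>2 = 0\<close> when \<open>X = 0\<close>.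
\<close>

lemma card_colour_hit:
  assumes t: "t \<in> {1..<n}" and J: "card J = 2 ^ t" "inj_on D J"
    and D: "\<And>x. x \<in> J \<Longrightarrow> D x \<subseteq> {1..n} \<and> D x \<noteq> {}"
  shows "card (seeds n) \<le> 2 * card {\<omega> \<in> seeds n. t \<in> (\<lambda>x. colour n \<omega> (D x)) ` J}"
proof -
  define N :: real where "N = real (card (seeds n))"
  define h :: "_ \<Rightarrow> _ \<Rightarrow> real" where "h x \<omega> = of_bool (colour n \<omega> (D x) = t)" for x \<omega>
  define X where "X \<omega> = (\<Sum>x\<in>J. h x \<omega>)" for \<omega>
  have finJ: "finite J" using J(1) by (metis card.infinite power_not_zero zero_neq_numeral)
  have h1: "(\<Sum>\<omega>\<in>seeds n. h x \<omega>) = N / 2 ^ t" if "x \<in> J" for x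
  proof -
    have "(\<Sum>\<omega>\<in>seeds n. h x \<omega>) = real (card {\<omega> \<in> seeds n. colour n \<omega> (D x) = t})"
      by (simp add: h_def of_bool_def sum.If_cases finite_seeds Int_def)
    moreover have "real (2 ^ t * card {\<omega> \<in> seeds n. colour n \<omega> (D x) = t}) = N"
      unfolding N_def using card_colour_eq[OF t] D[OF that] by simp
    ultimately show ?thesis by (simp add: field_simps)
  qed
  have h2: "(\<Sum>\<omega>\<in>seeds n. h x \<omega> * h y \<omega>) = N / 4 ^ t" if "x \<in> J" "y \<in> J" "x \<noteq> y" for x y
  proof -
    have "D x \<noteq> D y" using that J(2) by (auto simp: inj_on_def)
    then have "real (4 ^ t * card {\<omega> \<in> seeds n. colour n \<omega> (D x) = t \<and> colour n \<omega> (D y) = t}) = N"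
      unfolding N_def using card_colour_pair_eq[OF t] D that by simp
    moreover have "(\<Sum>\<omega>\<in>seeds n. h x \<omega> * h y \<omega>)
        = (\<Sum>\<omega>\<in>seeds n. of_bool (colour n \<omega> (D x) = t \<and> colour n \<omega> (D y) = t))"
      by (intro sum.cong) (auto simp: h_def)
    then have "(\<Sum>\<omega>\<in>seeds n. h x \<omega> * h y \<omega>)
        = real (card {\<omega> \<in> seeds n. colour n \<omega> (D x) = t \<and> colour n \<omega> (D y) = t})"
      by (simp add: of_bool_def sum.If_cases finite_seeds Int_def)
    ultimately show ?thesis by (simp add: field_simps)
  qed
  \<comment> \<open>There are \<open>2 ^ t\<close> sets, each of colour \<open>t\<close> with
    frequency \<open>1 / 2 ^ t\<close>; this balance is why \<open>J\<close> has exactly that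
    size.\<close>
  have EX: "(\<Sum>\<omega>\<in>seeds n. X \<omega>) = N"
    unfolding X_def by (subst sum.swap) (simp add: h1 J(1))
  have "(\<Sum>\<omega>\<in>seeds n. X \<omega> * X \<omega>) = (\<Sum>x\<in>J. \<Sum>y\<in>J. \<Sum>\<omega>\<in>seeds n. h x \<omega> * h y \<omega>)"
  proof -
    have "(\<Sum>\<omega>\<in>seeds n. X \<omega> * X \<omega>) = (\<Sum>\<omega>\<in>seeds n. \<Sum>x\<in>J. \<Sum>y\<in>J. h x \<omega> * h y \<omega>)"
      by (simp add: X_def sum_product)
    also have "\<dots> = (\<Sum>x\<in>J. \<Sum>\<omega>\<in>seeds n. \<Sum>y\<in>J. h x \<omega> * h y \<omega>)" by (rule sum.swap)
    finally show ?thesis by (simp add: sum.swap[of _ J "seeds n"])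
  qed
  also have "\<dots> = (\<Sum>x\<in>J. N / 2 ^ t + (\<Sum>y\<in>J - {x}. N / 4 ^ t))"
  proof (intro sum.cong refl)
    fix x assume x: "x \<in> J"
    have "(\<Sum>\<omega>\<in>seeds n. h x \<omega> * h x \<omega>) = (\<Sum>\<omega>\<in>seeds n. h x \<omega>)"
      by (intro sum.cong) (auto simp: h_def)
    moreover have "(\<Sum>y\<in>J - {x}. \<Sum>\<omega>\<in>seeds n. h x \<omega> * h y \<omega>) = (\<Sum>y\<in>J - {x}. N / 4 ^ t)"
      using h2[OF x] by (intro sum.cong) auto
    ultimately show "(\<Sum>y\<in>J. \<Sum>\<omega>\<in>seeds n. h x \<omega> * h y \<omega>) = N / 2 ^ t + (\<Sum>y\<in>J - {x}. N / 4 ^ t)"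
      by (simp only: sum.remove[OF finJ x] h1[OF x])
  qed
  \<comment> \<open>Readmitting the diagonal index gives the round value
    \<open>2 ^ t * (1 / 2 ^ t + 2 ^ t / 4 ^ t) = 2\<close>.\<close>
  also have "\<dots> \<le> (\<Sum>x\<in>J. N / 2 ^ t + (\<Sum>y\<in>J. N / 4 ^ t))"
    by (intro sum_mono add_mono sum_mono2 finJ) (auto simp: N_def)
  also have "\<dots> = 2 * N"
    by (simp add: J(1) field_simps power_mult_distrib[symmetric])
  finally have EXX: "(\<Sum>\<omega>\<in>seeds n. X \<omega> * X \<omega>) \<le> 2 * N" .
  have "3 * X \<omega> - X \<omega> * X \<omega> \<le> 2 * of_bool (t \<in> (\<lambda>x. colour n \<omega> (D x)) ` J)" for \<omega>
  proof -
    define m where "m = card {x \<in> J. colour n \<omega> (D x) = t}"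
    have m: "X \<omega> = real m"
      by (simp add: X_def h_def m_def of_bool_def sum.If_cases finJ Int_def)
    show ?thesis
    proof (cases "t \<in> (\<lambda>x. colour n \<omega> (D x)) ` J")
      case True
      \<comment> \<open>A product of two consecutive integers is nonnegative. Integrality of the
        number of hits matters: the product is negative strictly between 1 and 2.\<close>
      have "(int m - 1) * (int m - 2) \<ge> 0"
        by (cases "m \<le> 1") (auto intro: mult_nonpos_nonpos)
      then have "real_of_int ((int m - 1) * (int m - 2)) \<ge> 0" by (simp only: of_int_0_le_iff)
      then show ?thesis using True by (simp add: m algebra_simps)
    next
      case False
      then have "{x \<in> J. colour n \<omega> (D x) = t} = {}" by auto
      then have "m = 0" unfolding m_def by (simp only: card.empty)
      then show ?thesis using m by simp
    qed
  qed
  then have "(\<Sum>\<omega>\<in>seeds n. 3 * X \<omega> - X \<omega> * X \<omega>)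
      \<le> (\<Sum>\<omega>\<in>seeds n. 2 * of_bool (t \<in> (\<lambda>x. colour n \<omega> (D x)) ` J))"
    by (rule sum_mono)
  also have "\<dots> = real (2 * card {\<omega> \<in> seeds n. t \<in> (\<lambda>x. colour n \<omega> (D x)) ` J})"
    by (simp add: sum_distrib_left[symmetric] of_bool_def sum.If_cases finite_seeds Int_def)
  finally have "N \<le> real (2 * card {\<omega> \<in> seeds n. t \<in> (\<lambda>x. colour n \<omega> (D x)) ` J})"
    using EX EXX by (simp add: sum_subtractf sum_distrib_left[symmetric])
  then show ?thesis by (simp only: N_def of_nat_le_iff)
qed

text \<open>Linearity of expectation over the colours \<open>t\<close> up to the binary logarithm of
  \<open>card J\<close>: each is attained for at least half of the seeds, by the second moment bound
  on a subset of \<open>J\<close> of size \<open>2 ^ t\<close>.\<close>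

lemma sum_card_colours_ge:
  assumes J: "finite J" "J \<noteq> {}" "card J \<le> n" "inj_on D J"
    and D: "\<And>x. x \<in> J \<Longrightarrow> D x \<subseteq> {1..n} \<and> D x \<noteq> {}"
  shows "real (card (seeds n)) * ln (real (card J))
    \<le> 3 * (\<Sum>\<omega>\<in>seeds n. real (card ((\<lambda>x. colour n \<omega> (D x)) ` J)))"
proof -
  define N :: real where "N = real (card (seeds n))"
  let ?k = "card J"
  let ?c = "\<lambda>\<omega>. (\<lambda>x. colour n \<omega> (D x)) ` J"
  let ?E = "\<Sum>\<omega>\<in>seeds n. real (card (?c \<omega>))"
  have k: "?k \<ge> 1" using J(1,2) by (simp add: Suc_le_eq card_gt_0_iff)
  \<comment> \<open>\<open>t0\<close> is the binary logarithm of \<open>card J\<close>, rounded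
    down. It lies below \<open>n\<close>, so every colour up to \<open>t0\<close> has a functional
    of its own.\<close>
  obtain t0 where t0: "2 ^ t0 \<le> ?k" "?k < 2 ^ (t0 + 1)"
    using ex_power_ivl1[of 2 ?k] k by auto
  have "t0 < n" using t0(1) J(3) less_exp[of t0] by linarith
  have "(\<Sum>\<omega>\<in>seeds n. 1) \<le> ?E"
  proof (intro sum_mono)
    fix \<omega>
    have "card (?c \<omega>) > 0" using J by (simp add: card_gt_0_iff)
    then show "1 \<le> real (card (?c \<omega>))" by linarith
  qed
  then have E1: "N \<le> ?E" by (simp add: N_def)
  have hit: "N / 2 \<le> (\<Sum>\<omega>\<in>seeds n. of_bool (t \<in> ?c \<omega>))" if t: "t \<in> {1..t0}" for t
  proof -
    have "2 ^ t \<le> ?k" using t by (intro order_trans[OF power_increasing t0(1)]) auto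
    then obtain J' where J': "J' \<subseteq> J" "card J' = 2 ^ t" by (meson obtain_subset_with_card_n)
    have "card (seeds n) \<le> 2 * card {\<omega> \<in> seeds n. t \<in> (\<lambda>x. colour n \<omega> (D x)) ` J'}"
      using t \<open>t0 < n\<close> J' D inj_on_subset[OF J(4) J'(1)] by (intro card_colour_hit) auto
    also have "\<dots> \<le> 2 * card {\<omega> \<in> seeds n. t \<in> ?c \<omega>}"
      using J'(1) finite_seeds by (intro mult_left_mono card_mono) auto
    finally have "N \<le> real (2 * card {\<omega> \<in> seeds n. t \<in> ?c \<omega>})"
      by (simp only: N_def of_nat_le_iff)
    then show ?thesis by (simp add: of_bool_def sum.If_cases finite_seeds Int_def)
  qed
  have "real t0 * (N / 2) = (\<Sum>t\<in>{1..t0}. N / 2)" by simp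
  also have "\<dots> \<le> (\<Sum>t\<in>{1..t0}. \<Sum>\<omega>\<in>seeds n. of_bool (t \<in> ?c \<omega>))"
    by (intro sum_mono hit)
  also have "\<dots> = (\<Sum>\<omega>\<in>seeds n. \<Sum>t\<in>{1..t0}. of_bool (t \<in> ?c \<omega>))" by (rule sum.swap)
  also have "\<dots> \<le> ?E"
  proof (intro sum_mono)
    fix \<omega>
    have "(\<Sum>t\<in>{1..t0}. of_bool (t \<in> ?c \<omega>)) = real (card ({1..t0} \<inter> ?c \<omega>))"
      by (simp add: of_bool_def sum.If_cases)
    also have "\<dots> \<le> real (card (?c \<omega>))" using J(1) by (intro of_nat_mono card_mono) auto
    finally show "(\<Sum>t\<in>{1..t0}. of_bool (t \<in> ?c \<omega>)) \<le> real (card (?c \<omega>))" .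
  qed
  finally have E2: "real t0 * N \<le> 2 * ?E" by simp
  have "real ?k \<le> 2 ^ (t0 + 1)" using t0(2) by (metis less_imp_le of_nat_le_iff of_nat_numeral of_nat_power)
  then have "ln (real ?k) \<le> ln (2 ^ (t0 + 1))" using k by (subst ln_le_cancel_iff) auto
  also have "\<dots> = real (t0 + 1) * ln 2" by (rule ln_realpow)
  also have "\<dots> \<le> real (t0 + 1) * 1" by (intro mult_left_mono) (use ln_le_minus_one[of 2] in auto)
  finally have "N * ln (real ?k) \<le> N * (real t0 + 1)"
    by (intro mult_left_mono) (auto simp: N_def)
  \<comment> \<open>\<open>E2\<close> pays for \<open>t0\<close> and \<open>E1\<close> for the
    summand 1, whence the constant 3 = 2 + 1.\<close>
  also have "\<dots> \<le> 3 * ?E" using E1 E2 by (simp add: algebra_simps)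
  finally show ?thesis by (simp add: N_def)
qed

section \<open>Rank and span over the two-element field\<close>

interpretation F2_bit: vector_space_pair scale_F2 "(*) :: bit \<Rightarrow> bit \<Rightarrow> bit"
  by unfold_locales (auto simp: algebra_simps)

lemma card_le_F2_dim:
  assumes "finite S" "I \<subseteq> S" "F2.independent I"
  shows "card I \<le> F2.dim S"
proof -
  obtain B where "B \<subseteq> S" "S \<subseteq> F2.span B" "card B = F2.dim S"
    by (rule F2.basis_exists)
  then show ?thesis
    using F2.independent_span_bound[OF finite_subset[OF _ assms(1)] assms(3), of B] assms(2) by auto
qed

lemma rank_F2_matroid:
  assumes "S \<subseteq> F2_space d"
  shows "rank (F2_matroid d) S = F2.dim S"
proof -
  have fin: "finite S" using assms finite_F2_space finite_subset by blast
  obtain B where B: "B \<subseteq> S" "F2.independent B" "card B = F2.dim S"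
    by (rule F2.basis_exists)
  have "finite {I. (I \<subseteq> F2_space d \<and> F2.independent I) \<and> I \<subseteq> S}"
    using fin by (auto intro: rev_finite_subset[of "Pow S"])
  then show ?thesis
    unfolding rank_def F2_matroid_def using B assms card_le_F2_dim[OF fin]
    by (intro Max_eqI) (auto simp: image_iff intro!: exI[of _ B])
qed

text \<open>Lets membership in a span be tested by ranks alone, the form in which a matroid offers
  it.\<close>

lemma dim_insert_eq_iff:
  assumes "finite S"
  shows "F2.dim (insert v S) = F2.dim S \<longleftrightarrow> v \<in> F2.span S"
proof
  assume "v \<in> F2.span S"
  then show "F2.dim (insert v S) = F2.dim S" by (intro F2.span_eq_dim F2.span_redundant)
next
  assume eq: "F2.dim (insert v S) = F2.dim S"
  show "v \<in> F2.span S"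
  proof (rule ccontr)
    assume v: "v \<notin> F2.span S"
    obtain B where B: "B \<subseteq> S" "F2.independent B" "S \<subseteq> F2.span B" "card B = F2.dim S"
      by (rule F2.basis_exists)
    have vB: "v \<notin> F2.span B" using v F2.span_mono[OF B(1)] by blast
    have "card (insert v B) = F2.dim (insert v S)"
    proof (rule F2.basis_card_eq_dim)
      show "insert v S \<subseteq> F2.span (insert v B)"
        using B(3) F2.span_mono[of B "insert v B"] F2.span_base[of v "insert v B"] by blast
      show "F2.independent (insert v B)" using vB B(2) by (rule F2.independent_insertI)
    qed (use B(1) in blast)
    moreover have "v \<notin> B" using vB F2.span_base by blast
    ultimately show False using eq B finite_subset[OF B(1) assms] by simp
  qed
qed

text \<open>All coefficients are 0 or 1, so collecting the indices with coefficient 1 turns a linear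
  combination into a subset sum.\<close>

lemma F2_span_subset_sum:
  assumes "finite G" "inj_on w G" "v \<in> F2.span (w ` G)"
  obtains E where "E \<subseteq> G" "v = (\<Sum>i\<in>E. w i)"
proof -
  obtain u where u: "v = (\<Sum>b\<in>w ` G. scale_F2 (u b) b)"
    using assms(1,3) by (auto simp: F2.span_finite)
  define E where "E = {i \<in> G. u (w i) = 1}"
  have "v = (\<Sum>i\<in>G. scale_F2 (u (w i)) (w i))" using u assms(2) by (simp add: sum.reindex)
  also have "\<dots> = (\<Sum>i\<in>G. if u (w i) = 1 then w i else 0)"
    by (intro sum.cong) (auto simp: scale_F2_def fun_eq_iff)
  also have "\<dots> = (\<Sum>i\<in>E. w i)" using assms(1) by (simp add: E_def sum.inter_filter)
  finally show thesis using that[of E] by (auto simp: E_def)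
qed

text \<open>The support of \<open>v\<close> in a basis is described by spans only: deleting a basis
  vector destroys membership exactly when its coefficient is 1. Hence the matroid determines the
  coordinates, whatever the representation.\<close>

lemma F2_coordinates:
  assumes G: "finite G" "inj_on w G" "F2.independent (w ` G)" and v: "v \<in> F2.span (w ` G)"
  shows "v = (\<Sum>i\<in>{i \<in> G. v \<notin> F2.span (w ` (G - {i}))}. w i)"
proof -
  obtain E where E: "E \<subseteq> G" "v = (\<Sum>i\<in>E. w i)" using F2_span_subset_sum[OF G(1,2) v] .
  have "v \<in> F2.span (w ` (G - {i}))" if "i \<notin> E" for i
    unfolding E(2) using E(1) that by (intro F2.span_sum F2.span_base) auto
  moreover have "v \<notin> F2.span (w ` (G - {i}))" if i: "i \<in> E" for i
  proof
    assume "v \<in> F2.span (w ` (G - {i}))"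
    moreover have "(\<Sum>j\<in>E - {i}. w j) \<in> F2.span (w ` (G - {i}))"
      using E(1) by (intro F2.span_sum F2.span_base) auto
    moreover have "w i = v - (\<Sum>j\<in>E - {i}. w j)"
      unfolding E(2) using i finite_subset[OF E(1) G(1)] by (simp add: sum.remove[of E i])
    ultimately have "w i \<in> F2.span (w ` (G - {i}))" using F2.span_diff by simp
    moreover have "w ` (G - {i}) = w ` G - {w i}"
      using G(2) E(1) i by (auto simp: inj_on_def)
    ultimately show False using G(3) E(1) i unfolding F2.dependent_def by auto
  qed
  ultimately have "E = {i \<in> G. v \<notin> F2.span (w ` (G - {i}))}" using E(1) by blast
  then show ?thesis using E(2) by simp
qed

text \<open>Induction on \<open>j\<close>: the next vector is either redundant for the span or
  extends the basis. Injectivity is tracked because \<open>w\<close> may repeat values.\<close>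

lemma greedy_basis_F2:
  fixes w :: "nat \<Rightarrow> nat \<Rightarrow> bit"
  defines "G \<equiv> \<lambda>j. {i \<in> {1..j}. w i \<notin> F2.span (w ` {1..<i})}"
  shows "inj_on w (G j) \<and> F2.independent (w ` G j) \<and> F2.span (w ` G j) = F2.span (w ` {1..j})"
proof (induction j)
  case 0
  have "G 0 = {}" by (auto simp: G_def)
  then show ?case by (simp add: F2.independent_empty)
next
  case (Suc j)
  have ran: "{1..Suc j} = insert (Suc j) {1..j}" "{1..<Suc j} = {1..j}" by auto
  have span: "F2.span (w ` {1..Suc j}) = F2.span (insert (w (Suc j)) (w ` G j))"
    unfolding ran image_insert
    by (subst (1 2) F2.span_insert) (simp only: Suc.IH)
  show ?case
  proof (cases "w (Suc j) \<in> F2.span (w ` {1..j})")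
    case True
    then have "G (Suc j) = G j"
      by (auto simp: G_def le_Suc_eq atLeastLessThanSuc_atLeastAtMost)
    then show ?thesis using Suc.IH span True by (simp add: F2.span_redundant)
  next
    case False
    then have "G (Suc j) = insert (Suc j) (G j)"
      by (auto simp: G_def le_Suc_eq atLeastLessThanSuc_atLeastAtMost)
    moreover have "w (Suc j) \<notin> F2.span (w ` G j)" using False Suc.IH by simp
    moreover have "w (Suc j) \<notin> w ` G j" using calculation(2) F2.span_base[of "w (Suc j)" "w ` G j"] by blast
    moreover have "F2.independent (insert (w (Suc j)) (w ` G j))"
      using calculation(2) Suc.IH by (intro F2.independent_insertI) auto
    ultimately show ?thesis using Suc.IH span by auto
  qed
qed

lemma sum_bit_eq_parity:
  "finite D \<Longrightarrow> (\<Sum>i\<in>D. of_bool (i \<in> W) :: bit) = of_bool (odd (card (D \<inter> W)))"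
  by (induction D rule: finite_induct) (auto simp: Int_insert_left)

text \<open>Prescribe the indicator of \<open>W\<close> on the basis vectors and extend linearly; a
  sum of indicators over the two-element field is a parity. This realises a set of the seed as a
  functional.\<close>

lemma exists_parity_functional:
  assumes G: "finite G" "inj_on w G" "F2.independent (w ` G)"
  obtains l where "Vector_Spaces.linear scale_F2 (*) l"
    "\<And>D. D \<subseteq> G \<Longrightarrow> l (\<Sum>i\<in>D. w i) = (of_bool (odd (card (D \<inter> W))) :: bit)"
proof -
  obtain l where l: "Vector_Spaces.linear scale_F2 (*) l"
    "\<And>x. x \<in> w ` G \<Longrightarrow> l x = (of_bool (inv_into G w x \<in> W) :: bit)"
    using F2_bit.linear_independent_extend[OF G(3), of "\<lambda>x. of_bool (inv_into G w x \<in> W)"] by blast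
  have "l (\<Sum>i\<in>D. w i) = of_bool (odd (card (D \<inter> W)))" if "D \<subseteq> G" for D
  proof -
    have "l (\<Sum>i\<in>D. w i) = (\<Sum>i\<in>D. l (w i))" by (rule F2_bit.linear_sum[OF l(1)])
    also have "\<dots> = (\<Sum>i\<in>D. of_bool (i \<in> W))"
      using that G(2) by (intro sum.cong refl) (auto simp: l(2) inv_into_f_f)
    also have "\<dots> = of_bool (odd (card (D \<inter> W)))"
      by (rule sum_bit_eq_parity[OF finite_subset[OF that G(1)]])
    finally show ?thesis .
  qed
  then show thesis using that l(1) by blast
qed

text \<open>A vector of least level is separated from the span of the others by the functional of its level.\<close>

lemma independent_if_triangular:
  fixes level :: "_ \<Rightarrow> nat"
  assumes "finite X" "0 \<notin> X" "inj_on level X" "\<And>x. x \<in> X \<Longrightarrow> level x \<le> n"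
    and lin: "\<And>t. t < n \<Longrightarrow> Vector_Spaces.linear scale_F2 (*) (l t)"
    and one: "\<And>x. x \<in> X \<Longrightarrow> level x < n \<Longrightarrow> l (level x) x = (1 :: bit)"
    and zero: "\<And>x y. x \<in> X \<Longrightarrow> y \<in> X \<Longrightarrow> level x < level y \<Longrightarrow> l (level x) y = 0"
  shows "F2.independent X"
  using assms(1-4) one zero
proof (induction "card X" arbitrary: X)
  case 0
  then show ?case by (simp add: F2.independent_empty)
next
  case (Suc k)
  define x where "x = arg_min_on level X"
  have "X \<noteq> {}" using Suc.hyps(2) by auto
  have x: "x \<in> X" "\<And>y. y \<in> X \<Longrightarrow> level x \<le> level y"
    unfolding x_def using arg_min_if_finite(1)[OF Suc.prems(1) \<open>X \<noteq> {}\<close>, of level]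
      arg_min_least[OF Suc.prems(1) \<open>X \<noteq> {}\<close>, of _ level] by simp_all
  have lt: "level x < level y" if "y \<in> X - {x}" for y
    using that x Suc.prems(3) by (metis DiffE inj_onD insertI1 le_neq_implies_less)
  have ind: "F2.independent (X - {x})"
    using Suc.prems Suc.hyps(2) x(1) by (intro Suc.hyps(1)) (auto simp: inj_on_diff)
  have "x \<notin> F2.span (X - {x})"
  proof (cases "level x < n")
    case True
    have *: "l (level x) y = 0" if "y \<in> X - {x}" for y
      using Suc.prems(6)[OF x(1) DiffD1[OF that] lt[OF that]] .
    have "l (level x) y = 0" if "y \<in> F2.span (X - {x})" for y
      using lin[OF True] * that by (rule F2_bit.linear_eq_0_on_span)
    then show ?thesis using Suc.prems(5)[OF x(1) True] by auto
  next
    case False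
    \<comment> \<open>A least level of \<open>n\<close> is also the largest possible one, so
      injectivity leaves no other vector, and \<open>x\<close> being nonzero suffices.\<close>
    have "X - {x} = {}" using False lt Suc.prems(4) by fastforce
    show ?thesis using x(1) Suc.prems(2) unfolding \<open>X - {x} = {}\<close> F2.span_empty by auto
  qed
  then have "F2.independent (insert x (X - {x}))" using ind by (rule F2.independent_insertI)
  then show ?case using x(1) by (simp add: insert_absorb)
qed

section \<open>Fundamental sets of an ordered matroid\<close>

lemma rank_indep:
  assumes "matroid M" "I \<in> indeps M"
  shows "rank M I = card I"
proof -
  have "finite (ground M)" "I \<subseteq> ground M" using assms by (auto simp: matroid_def)
  then have fin: "finite I" by (rule finite_subset[rotated])
  then have "finite {J \<in> indeps M. J \<subseteq> I}" by (auto intro: rev_finite_subset[of "Pow I"])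
  then show ?thesis
    unfolding rank_def using assms(2) fin by (intro Max_eqI) (auto intro: card_mono)
qed

lemma obtain_indep_card_rank:
  assumes "matroid M"
  obtains I where "I \<in> indeps M" "I \<subseteq> S" "card I = rank M S"
proof -
  let ?A = "{I \<in> indeps M. I \<subseteq> S}"
  have "finite (indeps M)" "{} \<in> ?A"
    using assms unfolding matroid_def by (auto intro: rev_finite_subset[of "Pow (ground M)"])
  then have "Max (card ` ?A) \<in> card ` ?A" by (intro Max_in) auto
  then show thesis using that unfolding rank_def by auto
qed

text \<open>Phrased by ranks rather than by a representation: representations of a matroid and of
  its prefix could be chosen inconsistently, while ranks agree.\<close>

definition spanned :: "'a pre_matroid \<Rightarrow> 'a set \<Rightarrow> 'a \<Rightarrow> bool" where
  "spanned M A x \<longleftrightarrow> rank M (insert x A) = rank M A"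

definition greedy_basis :: "'a pre_matroid \<Rightarrow> (nat \<Rightarrow> 'a) \<Rightarrow> nat \<Rightarrow> nat set" where
  "greedy_basis M \<pi> j = {i \<in> {1..j}. \<not> spanned M (\<pi> ` {1..<i}) (\<pi> i)}"

text \<open>Equals \<open>{j}\<close> if \<open>j\<close> is itself in the basis, and the fundamental circuit without \<open>j\<close> otherwise.\<close>

definition fundamental_set :: "'a pre_matroid \<Rightarrow> (nat \<Rightarrow> 'a) \<Rightarrow> nat \<Rightarrow> nat set" where
  "fundamental_set M \<pi> j =
     {i \<in> greedy_basis M \<pi> j. \<not> spanned M (\<pi> ` (greedy_basis M \<pi> j - {i})) (\<pi> j)}"

text \<open>The seed meets the matroid only through positions in the ordering, so it can be drawn
  before anything about the matroid is known.\<close>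

definition online_colour ::
  "nat \<Rightarrow> (nat \<Rightarrow> nat set) \<Rightarrow> 'a pre_matroid \<Rightarrow> (nat \<Rightarrow> 'a) \<Rightarrow> 'a \<Rightarrow> nat" where
  "online_colour n \<omega> M \<pi> x = colour n \<omega> (fundamental_set M \<pi> (inv_into {1..card (ground M)} \<pi> x))"

lemma fundamental_set_bound: "fundamental_set M \<pi> j \<subseteq> {1..j}"
  by (auto simp: fundamental_set_def greedy_basis_def)

section \<open>Invariance under passing to a prefix\<close>

lemma spanned_restriction:
  assumes "insert x A \<subseteq> X"
  shows "spanned (restriction M X) A x \<longleftrightarrow> spanned M A x"
proof -
  have "rank (restriction M X) B = rank M B" if "B \<subseteq> X" for B
  proof -
    have "{I \<in> indeps (restriction M X). I \<subseteq> B} = {I \<in> indeps M. I \<subseteq> B}"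
      using that by (auto simp: restriction_def)
    then show ?thesis by (simp add: rank_def)
  qed
  then show ?thesis using assms by (simp add: spanned_def)
qed

lemma spanned_prefix:
  assumes "A \<subseteq> {1..m}" "j \<in> {1..m}"
  shows "spanned (restriction M (\<pi> ` {1..m})) (restrict \<pi> {1..m} ` A) (restrict \<pi> {1..m} j)
    \<longleftrightarrow> spanned M (\<pi> ` A) (\<pi> j)"
proof -
  have "restrict \<pi> {1..m} ` A = \<pi> ` A" using assms(1) by (intro image_cong) auto
  then show ?thesis using assms by (auto intro!: spanned_restriction)
qed

text \<open>Every rank query behind the fundamental set of \<open>j\<close> concerns positions up to
  \<open>j\<close>, all inside the prefix.\<close>

lemma fundamental_set_prefix:
  assumes "j \<in> {1..m}"
  shows "fundamental_set (restriction M (\<pi> ` {1..m})) (restrict \<pi> {1..m}) j = fundamental_set M \<pi> j"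
proof -
  have G: "greedy_basis (restriction M (\<pi> ` {1..m})) (restrict \<pi> {1..m}) j = greedy_basis M \<pi> j"
    unfolding greedy_basis_def using assms by (intro Collect_cong conj_cong refl) (subst spanned_prefix, auto)
  have "greedy_basis M \<pi> j - {i} \<subseteq> {1..m}" for i
    using assms by (auto simp: greedy_basis_def)
  then show ?thesis unfolding fundamental_set_def G by (simp only: spanned_prefix assms)
qed

lemma online_colour_prefix:
  assumes \<pi>: "ordering M \<pi>" and m: "m < card (ground M)" and x: "x \<in> \<pi> ` {1..m}"
  shows "online_colour n \<omega> (restriction M (\<pi> ` {1..m})) (restrict \<pi> {1..m}) x = online_colour n \<omega> M \<pi> x"
proof -
  have inj: "inj_on \<pi> {1..card (ground M)}" using \<pi> by (auto simp: ordering_def bij_betw_def)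
  then have inj': "inj_on \<pi> {1..m}" by (rule inj_on_subset) (use m in auto)
  obtain j where j: "j \<in> {1..m}" "x = \<pi> j" using x by blast
  have "card (ground (restriction M (\<pi> ` {1..m}))) = m"
    using inj' by (simp add: restriction_def card_image)
  moreover have "inv_into {1..m} (restrict \<pi> {1..m}) x = j"
    using inv_into_f_f[of "restrict \<pi> {1..m}" "{1..m}" j] inj' j by simp
  moreover have "inv_into {1..card (ground M)} \<pi> x = j"
    using inv_into_f_f[OF inj, of j] j m by simp
  ultimately show ?thesis
    unfolding online_colour_def using fundamental_set_prefix[OF j(1), of M \<pi>] by simp
qed

section \<open>Analysis of the colouring through a fixed binary representation\<close>

locale ordered_binary_matroid =
  fixes M :: "'a pre_matroid" and \<pi> d \<phi>
  assumes matroid: "matroid M" and loop_free: "loop_free M"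
    and rank_preserving: "rank_preserving M (F2_matroid d) \<phi>"
    and ordering: "ordering M \<pi>"
begin

abbreviation "m \<equiv> card (ground M)"
abbreviation "w i \<equiv> \<phi> (\<pi> i)"

lemma finite_ground: "finite (ground M)"
  using matroid by (simp add: matroid_def)

lemma image_ordering: "\<pi> ` {1..m} = ground M" and inj_ordering: "inj_on \<pi> {1..m}"
  using ordering by (auto simp: ordering_def bij_betw_def)

lemma rank_eq_dim:
  assumes "S \<subseteq> ground M"
  shows "rank M S = F2.dim (\<phi> ` S)"
proof -
  have "\<phi> ` S \<subseteq> F2_space d"
    using assms rank_preserving by (auto simp: rank_preserving_def F2_matroid_def)
  then show ?thesis
    using rank_F2_matroid[of "\<phi> ` S" d] rank_preserving assms by (simp add: rank_preserving_def)
qed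

lemma spanned_iff:
  assumes "A \<subseteq> {1..m}" "j \<in> {1..m}"
  shows "spanned M (\<pi> ` A) (\<pi> j) \<longleftrightarrow> w j \<in> F2.span (w ` A)"
proof -
  have "insert (\<pi> j) (\<pi> ` A) \<subseteq> ground M" using assms image_ordering by blast
  then show ?thesis
    using dim_insert_eq_iff[of "w ` A" "w j"] finite_subset[OF assms(1)]
    by (simp add: spanned_def rank_eq_dim image_image)
qed

lemma greedy_basis_eq:
  assumes "j \<le> m"
  shows "greedy_basis M \<pi> j = {i \<in> {1..j}. w i \<notin> F2.span (w ` {1..<i})}"
  unfolding greedy_basis_def
  using assms by (intro Collect_cong conj_cong refl) (subst spanned_iff, auto)

lemma greedy_basis:
  assumes "j \<le> m"
  shows "inj_on w (greedy_basis M \<pi> j)" "F2.independent (w ` greedy_basis M \<pi> j)"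
    "F2.span (w ` greedy_basis M \<pi> j) = F2.span (w ` {1..j})"
  unfolding greedy_basis_eq[OF assms] using greedy_basis_F2[of w j] by blast+

lemma fundamental_set_subset:
  assumes "j \<le> m"
  shows "fundamental_set M \<pi> j \<subseteq> greedy_basis M \<pi> m"
  using assms by (auto simp: fundamental_set_def greedy_basis_def)

text \<open>With ranks translated into spans, the fundamental set is the support of
  \<open>w j\<close> in the greedy basis.\<close>

lemma sum_fundamental_set:
  assumes j: "j \<in> {1..m}"
  shows "w j = (\<Sum>i\<in>fundamental_set M \<pi> j. w i)"
proof -
  let ?G = "greedy_basis M \<pi> j"
  have jm: "j \<le> m" using j by simp
  have G: "?G \<subseteq> {1..m}" using j by (auto simp: greedy_basis_def)
  then have eq: "fundamental_set M \<pi> j = {i \<in> ?G. w j \<notin> F2.span (w ` (?G - {i}))}"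
    unfolding fundamental_set_def using j by (intro Collect_cong conj_cong refl) (subst spanned_iff, auto)
  have "w j \<in> F2.span (w ` ?G)"
    unfolding greedy_basis(3)[OF jm] using j by (intro F2.span_base) auto
  then show ?thesis
    unfolding eq by (rule F2_coordinates[OF finite_subset[OF G finite_atLeastAtMost] greedy_basis(1,2)[OF jm]])
qed

text \<open>This is where loop-freeness enters: a loop would still receive a colour, giving an image
  of cardinality 1 for a set of rank 0.\<close>

lemma representation_nonzero:
  assumes "x \<in> ground M"
  shows "\<phi> x \<noteq> 0"
proof
  assume "\<phi> x = 0"
  have "F2.dim {\<phi> x} = 1"
    using rank_eq_dim[of "{x}"] rank_indep[OF matroid, of "{x}"] assms loop_free
    by (simp add: loop_free_def)
  moreover have "F2.dim {} = 0" by (simp add: F2.dim_eq_card_independent F2.independent_empty)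
  ultimately show False using dim_insert_eq_iff[of "{}" "\<phi> x"] \<open>\<phi> x = 0\<close> by (simp add: F2.span_empty)
qed

lemma representation_inj_on_indep:
  assumes "I \<in> indeps M"
  shows "inj_on \<phi> I"
proof (rule inj_onI, rule ccontr)
  fix x y assume xy: "x \<in> I" "y \<in> I" "\<phi> x = \<phi> y" "x \<noteq> y"
  have I: "I \<subseteq> ground M" "\<And>J. J \<subseteq> I \<Longrightarrow> J \<in> indeps M"
    using matroid assms by (auto simp: matroid_def)
  then have sub: "J \<in> indeps M" "J \<subseteq> ground M" if "J \<subseteq> I" for J
    using that by auto
  have "card J = F2.dim (\<phi> ` J)" if "J \<subseteq> I" for J
    using rank_indep[OF matroid sub(1)[OF that]] rank_eq_dim[OF sub(2)[OF that]] by simp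
  \<comment> \<open>The two sets have the same image under \<open>\<phi>\<close>, but cardinalities
    2 and 1.\<close>
  from this[of "{x, y}"] this[of "{x}"] show False using xy by simp
qed

lemma online_colour_ordering:
  "j \<in> {1..m} \<Longrightarrow> online_colour n \<omega> M \<pi> (\<pi> j) = colour n \<omega> (fundamental_set M \<pi> j)"
  unfolding online_colour_def by (simp only: inv_into_f_f[OF inj_ordering])

text \<open>Choose one vector per colour; the functionals realising \<open>\<omega>\<close> make
  these vectors triangular, hence independent. The bound holds for every \<open>\<omega>\<close>,
  even outside \<open>seeds n\<close>.\<close>

lemma card_online_colour_le_rank:
  assumes n: "1 \<le> n" and S: "S \<subseteq> ground M"
  shows "card (online_colour n \<omega> M \<pi> ` S) \<le> rank M S"
proof -
  let ?G = "greedy_basis M \<pi> m"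
  have finG: "finite ?G" by (simp add: greedy_basis_def)
  have "\<exists>l. Vector_Spaces.linear scale_F2 (*) l \<and>
      (\<forall>D\<subseteq>?G. l (\<Sum>i\<in>D. w i) = (of_bool (odd (card (D \<inter> \<omega> t))) :: bit))" for t
    by (rule exists_parity_functional[OF finG greedy_basis(1,2)[OF order_refl], of "\<omega> t"]) blast
  then have "\<exists>l. \<forall>t. Vector_Spaces.linear scale_F2 (*) (l t) \<and>
      (\<forall>D\<subseteq>?G. l t (\<Sum>i\<in>D. w i) = (of_bool (odd (card (D \<inter> \<omega> t))) :: bit))"
    by (intro choice allI)
  then obtain l where l: "\<And>t. Vector_Spaces.linear scale_F2 (*) (l t)"
    "\<And>t D. D \<subseteq> ?G \<Longrightarrow> l t (\<Sum>i\<in>D. w i) = (of_bool (odd (card (D \<inter> \<omega> t))) :: bit)"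
    by blast
  \<comment> \<open>The colour recipe applied to vectors, so that elements represented by the same
    vector visibly share a colour.\<close>
  define level where "level v = Min (insert n {t \<in> {1..<n}. l t v = 1})" for v
  have lw: "l t (w j) = of_bool (odd (card (fundamental_set M \<pi> j \<inter> \<omega> t)))" if "j \<in> {1..m}" for j t
  proof -
    have "l t (w j) = l t (\<Sum>i\<in>fundamental_set M \<pi> j. w i)"
      by (rule arg_cong[OF sum_fundamental_set[OF that]])
    also have "\<dots> = of_bool (odd (card (fundamental_set M \<pi> j \<inter> \<omega> t)))"
      using that by (intro l(2) fundamental_set_subset) simp
    finally show ?thesis .
  qed
  have level: "level (w j) = colour n \<omega> (fundamental_set M \<pi> j)" if "j \<in> {1..m}" for j
    by (simp add: level_def colour_def lw[OF that])
  have "online_colour n \<omega> M \<pi> x = level (\<phi> x)" if "x \<in> S" for x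
  proof -
    have "x \<in> \<pi> ` {1..m}" using that S image_ordering by blast
    then obtain j where "j \<in> {1..m}" "x = \<pi> j" by blast
    then show ?thesis using level online_colour_ordering by simp
  qed
  then have "online_colour n \<omega> M \<pi> ` S = level ` \<phi> ` S"
    unfolding image_image by (rule image_cong[OF refl])
  moreover obtain X where "X \<subseteq> \<phi> ` S" "inj_on level X" "level ` \<phi> ` S = level ` X"
    using subset_image_inj[THEN iffD1, OF order_refl] by metis
  ultimately have X: "X \<subseteq> \<phi> ` S" "inj_on level X" "online_colour n \<omega> M \<pi> ` S = level ` X"
    by simp_all
  have finS: "finite (\<phi> ` S)" using finite_subset[OF S finite_ground] by simp
  have Xw: "\<exists>j\<in>{1..m}. v = w j" if v: "v \<in> X" for v
  proof -
    obtain x where x: "x \<in> S" "v = \<phi> x" using v X(1) by blast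
    then have "x \<in> \<pi> ` {1..m}" using S image_ordering by blast
    then show ?thesis using x(2) by blast
  qed
  have "F2.independent X"
  proof (rule independent_if_triangular[where level = level and n = n and l = l])
    show "finite X" using X(1) finS by (rule finite_subset)
    show "0 \<notin> X" using X(1) S representation_nonzero by (metis imageE subsetD)
    show "level x \<le> n" if "x \<in> X" for x
      using Xw[OF that] level colour_range[OF n] by auto
    show "l (level x) x = 1" if "x \<in> X" "level x < n" for x
      using Xw[OF that(1)] that(2) odd_if_colour_lt[OF n] by (auto simp: level lw)
    show "l (level x) y = 0" if xy: "x \<in> X" "y \<in> X" "level x < level y" for x y
    proof -
      obtain i j where ij: "i \<in> {1..m}" "j \<in> {1..m}" "x = w i" "y = w j"
        using Xw[OF xy(1)] Xw[OF xy(2)] by blast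
      have "level x \<ge> 1" "level y \<le> n"
        using ij colour_range[OF n] by (auto simp: level)
      then have "even (card (fundamental_set M \<pi> j \<inter> \<omega> (level x)))"
        using xy(3) ij by (intro even_if_lt_colour[of _ n]) (auto simp: level)
      then show ?thesis using lw[OF ij(2)] ij(4) by simp
    qed
  qed (use X(2) l(1) in auto)
  then have "card X \<le> rank M S" using card_le_F2_dim[OF finS X(1)] rank_eq_dim[OF S] by simp
  then show ?thesis using X(2,3) by (simp add: card_image)
qed

text \<open>Pass to a basis \<open>I\<close> of \<open>S\<close>. A fundamental set determines its
  vector, so these sets are nonempty, and they are distinct on \<open>I\<close> because
  \<open>\<phi>\<close> is injective there. Enlarging \<open>I\<close> to \<open>S\<close> can only
  add colours.\<close>

lemma sum_card_online_colour_ge: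
  assumes n: "m \<le> n" and S: "S \<subseteq> ground M" "rank M S > 0"
  shows "real (card (seeds n)) * ln (real (rank M S))
    \<le> 3 * (\<Sum>\<omega>\<in>seeds n. real (card (online_colour n \<omega> M \<pi> ` S)))"
proof -
  obtain I where I: "I \<in> indeps M" "I \<subseteq> S" "card I = rank M S"
    using obtain_indep_card_rank[OF matroid] by metis
  have Ig: "I \<subseteq> ground M" using I(2) S(1) by blast
  define D where "D x = fundamental_set M \<pi> (inv_into {1..m} \<pi> x)" for x
  have D: "\<phi> x = (\<Sum>i\<in>D x. w i)" "D x \<subseteq> {1..n}" if "x \<in> ground M" for x
  proof -
    have "x \<in> \<pi> ` {1..m}" using that image_ordering by simp
    then have j: "inv_into {1..m} \<pi> x \<in> {1..m}" "\<pi> (inv_into {1..m} \<pi> x) = x"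
      by (rule inv_into_into, rule f_inv_into_f)
    show "\<phi> x = (\<Sum>i\<in>D x. w i)" using sum_fundamental_set[OF j(1)] unfolding D_def j(2) .
    show "D x \<subseteq> {1..n}"
    proof -
      have "D x \<subseteq> {1..inv_into {1..m} \<pi> x}" unfolding D_def by (rule fundamental_set_bound)
      also have "\<dots> \<subseteq> {1..n}" using j(1) n by simp
      finally show ?thesis .
    qed
  qed
  have "D x \<noteq> {}" if "x \<in> ground M" for x
    using D(1)[OF that] representation_nonzero[OF that] by auto
  moreover have "inj_on D I"
  proof (rule inj_onI)
    fix x y assume xy: "x \<in> I" "y \<in> I" "D x = D y"
    have "x \<in> ground M" "y \<in> ground M" using xy Ig by auto
    then have "\<phi> x = \<phi> y" using D(1)[of x] D(1)[of y] xy(3) by simp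
    then show "x = y" using inj_onD[OF representation_inj_on_indep[OF I(1)]] xy(1,2) by blast
  qed
  moreover have "finite I" using Ig finite_ground by (rule finite_subset)
  moreover have "card I \<le> n" using card_mono[OF finite_ground Ig] n by simp
  moreover have "I \<noteq> {}" using I(3) S(2) by auto
  ultimately have "real (card (seeds n)) * ln (real (card I))
      \<le> 3 * (\<Sum>\<omega>\<in>seeds n. real (card ((\<lambda>x. colour n \<omega> (D x)) ` I)))"
    using D(2) Ig by (intro sum_card_colours_ge) auto
  also have "\<dots> \<le> 3 * (\<Sum>\<omega>\<in>seeds n. real (card (online_colour n \<omega> M \<pi> ` S)))"
    using I(2) finite_subset[OF S(1) finite_ground]
    by (intro mult_left_mono sum_mono of_nat_mono card_mono) (auto simp: online_colour_def D_def)
  finally show ?thesis by (simp add: I(3))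
qed

text \<open>Splits \<open>ln n = ln k + ln (n / k)\<close> with \<open>k\<close> the rank of \<open>S\<close>.\<close>

lemma mean_card_online_colour_ge:
  assumes n: "m \<le> n" "2 \<le> n" and S: "S \<subseteq> ground M"
  shows "ln (real n) / (4 * real n) * real (rank M S)
    \<le> (\<Sum>\<omega>\<in>seeds n. real (card (online_colour n \<omega> M \<pi> ` S))) / real (card (seeds n))"
    (is "_ \<le> ?E")
proof (cases "rank M S = 0")
  case True
  then show ?thesis by (auto intro!: divide_nonneg_nonneg sum_nonneg)
next
  case False
  define k where "k = real (rank M S)"
  have N: "real (card (seeds n)) > 0" using finite_seeds seeds_nonempty by (simp add: card_gt_0_iff)
  have finS: "finite S" using S finite_ground by (rule finite_subset)
  have k1: "k \<ge> 1" using False by (simp add: k_def)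
  obtain I where I: "I \<subseteq> S" "card I = rank M S"
    using obtain_indep_card_rank[OF matroid] by metis
  have "rank M S \<le> n"
    using card_mono[OF finite_ground subset_trans[OF I(1) S]] I(2) n(1) by simp
  then have kn: "k \<le> n" by (simp add: k_def)
  have "S \<noteq> {}" using I False by auto
  have "real (card (seeds n)) = (\<Sum>\<omega>\<in>seeds n. 1)" by simp
  also have "\<dots> \<le> (\<Sum>\<omega>\<in>seeds n. real (card (online_colour n \<omega> M \<pi> ` S)))"
  proof (intro sum_mono)
    fix \<omega>
    have "card (online_colour n \<omega> M \<pi> ` S) > 0" using finS \<open>S \<noteq> {}\<close> by (simp add: card_gt_0_iff)
    then show "1 \<le> real (card (online_colour n \<omega> M \<pi> ` S))" by linarith
  qed
  finally have E1: "1 \<le> ?E" using N by (simp add: field_simps)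
  have E2: "ln k \<le> 3 * ?E"
    using sum_card_online_colour_ge[OF n(1) S] False N by (simp add: k_def field_simps)
  have "ln (real n) = ln k + ln (real n / k)" using k1 n(2) by (simp add: ln_div)
  also have "\<dots> \<le> 3 * ?E + real n / k"
    using E2 ln_le_minus_one[of "real n / k"] k1 n(2) by simp
  finally have "ln (real n) * k \<le> (3 * ?E + real n / k) * k" using k1 by (intro mult_right_mono) auto
  also have "\<dots> = 3 * ?E * k + real n" using k1 by (simp add: distrib_right)
  \<comment> \<open>Uses \<open>k \<le> n\<close> in the first summand and \<open>1 \<le> ?E\<close>
    in the second; the final constant is 4 = 3 + 1.\<close>
  also have "\<dots> \<le> 3 * ?E * real n + ?E * real n"
  proof (rule add_mono)
    show "3 * ?E * k \<le> 3 * ?E * real n" using E1 kn by (intro mult_left_mono) auto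
    show "real n \<le> ?E * real n" using mult_right_mono[OF E1, of "real n"] by simp
  qed
  finally have "ln (real n) * k \<le> 4 * real n * ?E" by simp
  then show ?thesis using n(2) by (simp add: k_def field_simps)
qed

end

section \<open>Assembly with seeds coded as real numbers\<close>

theorem theorem13:
  "\<exists>C::real. C > 0 \<and> (\<forall>n::nat. n \<ge> 2 \<longrightarrow>
     (\<exists>\<beta>::real. \<beta> \<le> C * real n / ln (real n) \<and>
       (\<exists>(R :: real measure) (f :: 'a pre_matroid \<Rightarrow> (nat \<Rightarrow> 'a) \<Rightarrow> real \<Rightarrow> 'a \<Rightarrow> nat).
          online_randomized_embedding (loop_free_binary_matroids n) (free_matroid n) \<beta> R f)))"
proof (rule exI[of _ 4], intro conjI allI impI)
  fix n :: nat assume n: "n \<ge> 2"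
  define \<beta> where "\<beta> = 4 * real n / ln (real n)"
  obtain e :: "(nat \<Rightarrow> nat set) \<Rightarrow> nat" where e: "inj_on e (seeds n)"
    using finite_imp_inj_to_nat_seg[OF finite_seeds] by blast
  define p where "p = map_pmf (\<lambda>\<omega>. real (e \<omega>)) (pmf_of_set (seeds n))"
  \<comment> \<open>For reals that code no seed, \<open>inv_into\<close> returns an unspecified
    value. This is harmless: the range, the rank bound and the prefix property hold for arbitrary
    \<open>\<omega>\<close>, and \<open>p\<close> is supported on codes.\<close>
  define seed where "seed = inv_into (seeds n) (\<lambda>\<omega>. real (e \<omega>))"
  define f where "f M \<pi> r = online_colour n (seed r) M \<pi>" for M :: "'a pre_matroid" and \<pi> r
  have seed: "seed (real (e \<omega>)) = \<omega>" if "\<omega> \<in> seeds n" for \<omega>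
    unfolding seed_def using e that by (intro inv_into_f_f) (auto simp: inj_on_def)
  have finp: "finite (set_pmf p)" by (simp add: p_def finite_seeds seeds_nonempty)
  have E: "measure_pmf.expectation p (\<lambda>r. g (seed r)) = (\<Sum>\<omega>\<in>seeds n. g \<omega>) / real (card (seeds n))"
    for g :: "_ \<Rightarrow> real"
    by (simp add: p_def integral_pmf_of_set finite_seeds seeds_nonempty seed cong: sum.cong)
  have range: "f M \<pi> r x \<in> {1..n}" for M \<pi> r x
    unfolding f_def online_colour_def using n by (intro colour_range) simp
  have rank_f: "rank (free_matroid n) (f M \<pi> r ` S) = card (f M \<pi> r ` S)" for M \<pi> r S
    using range by (intro rank_free_matroid) blast
  have "online_randomized_embedding (loop_free_binary_matroids n) (free_matroid n) \<beta> (measure_pmf p) f"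
    unfolding online_randomized_embedding_def rank_f
  proof (intro conjI ballI allI impI)
    show "\<beta> > 0" using n by (simp add: \<beta>_def)
    show "prob_space (measure_pmf p)" by (rule measure_pmf.prob_space_axioms)
  next
    fix M :: "'a pre_matroid" and \<pi>
    assume M: "M \<in> loop_free_binary_matroids n" and \<pi>: "ordering M \<pi>"
    then obtain d \<phi> where "ordered_binary_matroid M \<pi> d \<phi>"
      by (auto simp: loop_free_binary_matroids_def binary_def ordered_binary_matroid_def)
    then interpret ordered_binary_matroid M \<pi> d \<phi> .
    show "f M \<pi> r \<in> ground M \<rightarrow> ground (free_matroid n)" for r
      using range by (simp add: free_matroid_def)
    fix S assume S: "S \<subseteq> ground M"
    show "AE r in measure_pmf p. card (f M \<pi> r ` S) \<le> rank M S"
      unfolding f_def using card_online_colour_le_rank[OF _ S, of n] n by simp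
    show "integrable (measure_pmf p) (\<lambda>r. real (card (f M \<pi> r ` S)))"
      using finp by (rule integrable_measure_pmf_finite)
    have "m \<le> n" using M by (simp add: loop_free_binary_matroids_def)
    then show "1 / \<beta> * real (rank M S) \<le> measure_pmf.expectation p (\<lambda>r. real (card (f M \<pi> r ` S)))"
      unfolding f_def E[of "\<lambda>\<omega>. real (card (online_colour n \<omega> M \<pi> ` S))"]
      using mean_card_online_colour_ge[OF _ n S] by (simp add: \<beta>_def)
  next
    fix M :: "'a pre_matroid" and \<pi> r m' x
    assume "ordering M \<pi>" "m' < card (ground M)" "x \<in> \<pi> ` {1..m'}"
    then show "f (restriction M (\<pi> ` {1..m'})) (restrict \<pi> {1..m'}) r x = f M \<pi> r x"
      unfolding f_def by (rule online_colour_prefix)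
  qed
  then show "\<exists>\<beta>::real. \<beta> \<le> 4 * real n / ln (real n) \<and>
       (\<exists>(R :: real measure) (f :: 'a pre_matroid \<Rightarrow> (nat \<Rightarrow> 'a) \<Rightarrow> real \<Rightarrow> 'a \<Rightarrow> nat).
          online_randomized_embedding (loop_free_binary_matroids n) (free_matroid n) \<beta> R f)"
    unfolding \<beta>_def by blast
qed simp

end
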